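(* Let $d\ge1$, let $K\colon\mathbb{R}^d\to[0,+\infty)$ be measurable and even ($K(h)=K(-h)$), and let $\Omega\subset\mathbb{R}^d$ be (non-empty) open and bounded. Suppose that $E_0\subset\mathbb{R}^d$ is a measurable set with $\operatorname{Per}_K(E_0,\Omega)<+\infty$ and define $$\mathcal{F}=\{F\subset\mathbb{R}^d\text{ measurable}:\ \operatorname{Per}_K(F,\Omega)<+\infty\ \text{and}\ F\cap\Omega^c=E_0\cap\Omega^c\}.$$ Then there exists $E\in\mathcal{F}$ such that $$\operatorname{Per}_K(E,\Omega)\le\operatorname{Per}_K(F,\Omega)\quad\text{for every }F\in\mathcal{F}.$$ Moreover, any such minimiser $E$ satisfies $$L_K(E,F)\le L_K(E^c\cap F^c,F)\quad\text{for every measurable }F\subset E^c\cap\Omega$$ and $$L_K(E^c,F)\le L_K(E\cap F^c,F)\quad\text{for every measurable }F\subset E\cap\Omega.$$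
   Context: For measurable sets $A,B\subset\mathbb{R}^d$, $L_K(A,B)=\int_B\int_AK(y-x)\,\mathrm{d}y\,\mathrm{d}x\in[0,+\infty]$, and $A^c$ denotes the complement of $A$ in $\mathbb{R}^d$. The nonlocal perimeter of $E$ in $\Omega$ is $$\operatorname{Per}_K(E,\Omega)=L_K(E\cap\Omega,E^c\cap\Omega)+L_K(E\cap\Omega,E^c\cap\Omega^c)+L_K(E\cap\Omega^c,E^c\cap\Omega).$$ *)

theory Defs
  imports "HOL-Analysis.Analysis"
begin

definition L_K :: "('a::euclidean_space \<Rightarrow> real) \<Rightarrow> 'a set \<Rightarrow> 'a set \<Rightarrow> ennreal" where
  "L_K K A B = (\<integral>\<^sup>+x\<in>B. (\<integral>\<^sup>+y\<in>A. ennreal (K (y - x)) \<partial>lebesgue) \<partial>lebesgue)"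

definition Per_K :: "('a::euclidean_space \<Rightarrow> real) \<Rightarrow> 'a set \<Rightarrow> 'a set \<Rightarrow> ennreal" where
  "Per_K K E \<Omega> =
     L_K K (E \<inter> \<Omega>) (- E \<inter> \<Omega>) + L_K K (E \<inter> \<Omega>) (- E \<inter> - \<Omega>) + L_K K (E \<inter> - \<Omega>) (- E \<inter> \<Omega>)"

definition admissible_sets ::
    "('a::euclidean_space \<Rightarrow> real) \<Rightarrow> 'a set \<Rightarrow> 'a set \<Rightarrow> 'a set set" where
  "admissible_sets K \<Omega> E\<^sub>0 =
     {F \<in> sets lebesgue. Per_K K F \<Omega> < \<infinity> \<and> F \<inter> - \<Omega> = E\<^sub>0 \<inter> - \<Omega>}"

definition is_minimiser ::
    "('a::euclidean_space \<Rightarrow> real) \<Rightarrow> 'a set \<Rightarrow> 'a set \<Rightarrow> 'a set \<Rightarrow> bool" where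
  "is_minimiser K \<Omega> E\<^sub>0 E \<longleftrightarrow>
     E \<in> admissible_sets K \<Omega> E\<^sub>0 \<and> (\<forall>F \<in> admissible_sets K \<Omega> E\<^sub>0. Per_K K E \<Omega> \<le> Per_K K F \<Omega>)"

end

theory Submission
  imports Defs
begin

text \<open>
  The perimeter is a measure of pairs. Let \<open>\<nu>\<close> be the measure on pairs \<open>(x, y)\<close> with density
  \<open>K (y - x)\<close>. Then \<open>L_K K A B = \<nu> (B \<times> A)\<close>, and \<open>Per_K K E \<Omega>\<close> is the \<open>\<nu>\<close>-mass of the pairs with
  \<open>x \<notin> E\<close>, \<open>y \<in> E\<close> that do not lie entirely outside \<open>\<Omega>\<close> (the pairs \<^emph>\<open>crossing\<close> the boundary
  of \<open>E\<close>).

  Existence of a minimiser comes from submodularity. Counting the crossing pairs of \<open>A \<union> B\<close> and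
  \<open>A \<inter> B\<close> shows that the perimeter is submodular, and continuity of \<open>\<nu>\<close> from below shows that it
  is lower semicontinuous along monotone sequences. If \<open>X n\<close> is admissible and within
  \<open>2\<^sup>-\<^sup>n\<close> of the infimum \<open>m\<close>, then by submodularity each set that is
  joined to a union costs only its own error, because the intersection discarded at that step has
  perimeter at least \<open>m\<close>. So \<open>(\<Union>n\<ge>N. X n)\<close> is within \<open>2 * 2\<^sup>-\<^sup>N\<close> of \<open>m\<close>, and the upper
  limit of the sets \<open>X n\<close> attains \<open>m\<close> (lemma \<open>submodular_attains_min\<close>).

  For the inequalities, compare a minimiser \<open>E\<close> with \<open>E \<union> F\<close> or \<open>E - F\<close>. The crossing pairs that
  the change destroys and those that it creates form two rectangles, whose masses are the two sides
  of the inequality; all other crossing pairs are common to both sets and have finite mass, so they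
  cancel.
\<close>

section \<open>Minimising submodular set functions\<close>

text \<open>
  The bound is carried in the form \<open>f (U j) + e (N + j) \<le> m + 2 * e N\<close> for the partial unions \<open>U j\<close>:
  the summand \<open>e (N + j)\<close> is exactly the total error that later sets may still contribute.
\<close>

lemma submodular_Union_le:
  fixes f :: "'a set \<Rightarrow> ennreal" and e :: "nat \<Rightarrow> ennreal"
  assumes Un: "\<And>A B. A \<in> \<A> \<Longrightarrow> B \<in> \<A> \<Longrightarrow> A \<union> B \<in> \<A>"
    and Int: "\<And>A B. A \<in> \<A> \<Longrightarrow> B \<in> \<A> \<Longrightarrow> A \<inter> B \<in> \<A>"
    and submodular: "\<And>A B. A \<in> \<A> \<Longrightarrow> B \<in> \<A> \<Longrightarrow> f (A \<union> B) + f (A \<inter> B) \<le> f A + f B"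
    and lsc: "\<And>X c. range X \<subseteq> \<A> \<Longrightarrow> incseq X \<Longrightarrow> (\<And>n::nat. f (X n) \<le> c) \<Longrightarrow> f (\<Union>n. X n) \<le> c"
    and lower: "\<And>A. A \<in> \<A> \<Longrightarrow> m \<le> f A" and "m < \<infinity>"
    and X: "\<And>n. X n \<in> \<A>" "\<And>n. f (X n) \<le> m + e n"
    and halving: "\<And>n. e n = e (Suc n) + e (Suc n)"
  shows "f (\<Union>n\<in>{N..}. X n) \<le> m + 2 * e N"
proof -
  define U where "U j = (\<Union>n\<in>{N..N + j}. X n)" for j
  have U_Suc: "U (Suc j) = U j \<union> X (Suc (N + j))" for j
    by (simp add: U_def atLeastAtMostSuc_conv Un_commute)
  have U0: "U 0 = X N"
    by (simp add: U_def)
  have U_in: "U j \<in> \<A>" for j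
    by (induction j) (simp_all add: U0 U_Suc X(1) Un)
  have join: "f (U (Suc j)) \<le> f (U j) + e (Suc (N + j))" for j
  proof -
    let ?V = "X (Suc (N + j))"
    have "m + f (U (Suc j)) \<le> f (U j \<union> ?V) + f (U j \<inter> ?V)"
      using lower[OF Int[OF U_in X(1)], of j "Suc (N + j)"]
      by (simp add: U_Suc add.commute add_left_mono)
    also have "\<dots> \<le> f (U j) + f ?V"
      by (intro submodular U_in X)
    also have "\<dots> \<le> m + (f (U j) + e (Suc (N + j)))"
      using add_left_mono[OF X(2)[of "Suc (N + j)"], of "f (U j)"] by (simp add: ac_simps)
    finally show ?thesis
      using \<open>m < \<infinity>\<close> by (auto simp: ennreal_add_left_cancel_le)
  qed
  have budget: "f (U j) + e (N + j) \<le> m + 2 * e N" for j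
  proof (induction j)
    case 0
    have "f (X N) + e N \<le> m + e N + e N"
      by (intro add_right_mono X)
    then show ?case
      by (simp add: U0 mult_2 add.assoc)
  next
    case (Suc j)
    have "f (U (Suc j)) + e (N + Suc j) \<le> f (U j) + (e (Suc (N + j)) + e (Suc (N + j)))"
      using add_right_mono[OF join[of j], of "e (Suc (N + j))"] by (simp add: ac_simps)
    also have "\<dots> = f (U j) + e (N + j)"
      by (simp add: halving[of "N + j"])
    finally show ?case
      using Suc by simp
  qed
  have "f (\<Union>j. U j) \<le> m + 2 * e N"
  proof (rule lsc)
    show "range U \<subseteq> \<A>"
      using U_in by auto
    show "incseq U"
      by (rule incseq_SucI) (auto simp: U_Suc)
    show "f (U j) \<le> m + 2 * e N" for j
      using budget[of j] by (meson add_increasing2 le_iff_add order_trans zero_le)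
  qed
  moreover have "(\<Union>j. U j) = (\<Union>n\<in>{N..}. X n)"
    by (force simp: U_def dest: le_Suc_ex)
  ultimately show ?thesis
    by simp
qed

text \<open>
  The upper limit of a fast minimising sequence is a minimiser: the unions of the tails of the
  sequence are almost optimal by the preceding lemma, and they decrease to the upper limit.
\<close>

lemma submodular_attains_min:
  fixes f :: "'a set \<Rightarrow> ennreal"
  assumes ne: "\<A> \<noteq> {}"
    and UN: "\<And>X. range X \<subseteq> \<A> \<Longrightarrow> (\<Union>n::nat. X n) \<in> \<A>"
    and INT: "\<And>X. range X \<subseteq> \<A> \<Longrightarrow> (\<Inter>n::nat. X n) \<in> \<A>"
    and submodular: "\<And>A B. A \<in> \<A> \<Longrightarrow> B \<in> \<A> \<Longrightarrow> f (A \<union> B) + f (A \<inter> B) \<le> f A + f B"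
    and lsc_inc: "\<And>X c. range X \<subseteq> \<A> \<Longrightarrow> incseq X \<Longrightarrow> (\<And>n::nat. f (X n) \<le> c) \<Longrightarrow> f (\<Union>n. X n) \<le> c"
    and lsc_dec: "\<And>X c. range X \<subseteq> \<A> \<Longrightarrow> decseq X \<Longrightarrow> (\<And>n::nat. f (X n) \<le> c) \<Longrightarrow> f (\<Inter>n. X n) \<le> c"
  shows "\<exists>E\<in>\<A>. \<forall>F\<in>\<A>. f E \<le> f F"
proof -
  define m where "m = (INF A\<in>\<A>. f A)"
  have lower: "m \<le> f A" if "A \<in> \<A>" for A
    using that by (simp add: m_def INF_lower)
  have Un: "A \<union> B \<in> \<A>" if "A \<in> \<A>" "B \<in> \<A>" for A B
  proof -
    have "A \<union> B = (\<Union>n::nat. if n = 0 then A else B)"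
      by (auto split: if_splits)
    then show ?thesis
      using UN[of "\<lambda>n. if n = 0 then A else B"] that by (simp add: image_subset_iff)
  qed
  have Int: "A \<inter> B \<in> \<A>" if "A \<in> \<A>" "B \<in> \<A>" for A B
  proof -
    have "A \<inter> B = (\<Inter>n::nat. if n = 0 then A else B)"
      by (auto split: if_splits)
    then show ?thesis
      using INT[of "\<lambda>n. if n = 0 then A else B"] that by (simp add: image_subset_iff)
  qed
  show ?thesis
  proof (cases "m = \<infinity>")
    case True
    then show ?thesis
      using ne lower by (metis ex_in_conv infinity_ennreal_def top.extremum_unique order_refl)
  next
    case False
    then have m: "m < \<infinity>"
      by (simp add: top.not_eq_extremum)
    define e :: "nat \<Rightarrow> ennreal" where "e n = ennreal ((1/2) ^ n)" for n
    have halving: "e n = e (Suc n) + e (Suc n)" for n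
      by (simp add: e_def flip: ennreal_plus)
    have "\<exists>A\<in>\<A>. f A \<le> m + e n" for n
    proof -
      have "m + 0 < m + e n"
        using m by (subst ennreal_add_left_cancel_less) (auto simp: e_def)
      then have "(INF A\<in>\<A>. f A) < m + e n"
        by (simp add: m_def)
      then show ?thesis
        unfolding INF_less_iff by (auto intro: less_imp_le)
    qed
    then obtain X where X: "\<And>n. X n \<in> \<A>" "\<And>n. f (X n) \<le> m + e n"
      by metis
    define V where "V N = (\<Union>n\<in>{N..}. X n)" for N
    have V_le: "f (V N) \<le> m + 2 * e N" for N
      unfolding V_def
      by (rule submodular_Union_le[where \<A> = \<A> and f = f and m = m and e = e and X = X,
            OF Un Int submodular lsc_inc lower m X halving])
    have V_in: "V N \<in> \<A>" for N
    proof -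
      have "V N = (\<Union>j. X (N + j))"
        by (force simp: V_def dest: le_Suc_ex)
      then show ?thesis
        using X(1) UN[of "\<lambda>j. X (N + j)"] by auto
    qed
    have V_dec: "decseq V"
      by (force simp: V_def decseq_def)
    have limsup_le: "f (\<Inter>n. V n) \<le> m + 2 * e N" for N
    proof -
      \<comment> \<open>Drop the first \<open>N\<close> tails: the remaining ones obey the bound uniformly.\<close>
      have "f (\<Inter>n. V (N + n)) \<le> m + 2 * e N"
      proof (rule lsc_dec)
        show "range (\<lambda>n. V (N + n)) \<subseteq> \<A>"
          using V_in by auto
        show "decseq (\<lambda>n. V (N + n))"
          using V_dec by (simp add: decseq_def)
        have "e (N + n) \<le> e N" for n
          by (auto simp: e_def intro!: ennreal_leI power_decreasing)
        then show "f (V (N + n)) \<le> m + 2 * e N" for n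
          by (intro order_trans[OF V_le] add_left_mono mult_left_mono) auto
      qed
      moreover have "(\<Inter>n. V n) = (\<Inter>n. V (N + n))"
        using decseqD[OF V_dec, of _ "N + _"]
        by (intro equalityI) (force, meson INT_greatest INT_lower le_add2 order_trans UNIV_I)
      ultimately show ?thesis
        by simp
    qed
    have "e \<longlonglongrightarrow> ennreal 0"
      unfolding e_def by (intro tendsto_ennrealI LIMSEQ_power_zero) simp
    then have "(\<lambda>N. m + 2 * e N) \<longlonglongrightarrow> m + 2 * 0"
      by (intro tendsto_add tendsto_const ennreal_tendsto_cmult) simp_all
    then have "f (\<Inter>n. V n) \<le> m"
      using limsup_le by (intro LIMSEQ_le_const[of "\<lambda>N. m + 2 * e N"]) auto
    moreover have "(\<Inter>n. V n) \<in> \<A>"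
      using V_in by (intro INT) auto
    ultimately show ?thesis
      using lower order_trans by blast
  qed
qed


section \<open>The mass of crossing pairs\<close>

definition crossing :: "'a set \<Rightarrow> 'a set \<Rightarrow> ('a \<times> 'a) set" where
  "crossing \<Omega> E = {(x, y). x \<notin> E \<and> y \<in> E \<and> (x \<in> \<Omega> \<or> y \<in> \<Omega>)}"

lemma crossing_eq_rectangles:
  "crossing \<Omega> E =
    (- E \<inter> \<Omega>) \<times> (E \<inter> \<Omega>) \<union> (- E \<inter> - \<Omega>) \<times> (E \<inter> \<Omega>) \<union> (- E \<inter> \<Omega>) \<times> (E \<inter> - \<Omega>)"
  by (auto simp: crossing_def)

lemma sets_crossing:
  assumes "space M = UNIV" "E \<in> sets M" "\<Omega> \<in> sets M"
  shows "crossing \<Omega> E \<in> sets (M \<Otimes>\<^sub>M M)"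
proof -
  have compl: "- A \<in> sets M" if "A \<in> sets M" for A
    using sets.compl_sets[OF that] assms(1) by (simp add: Compl_eq_Diff_UNIV)
  show ?thesis
    unfolding crossing_eq_rectangles using assms(2,3) compl by auto
qed

text \<open>
  A pair that crosses both \<open>A \<union> B\<close> and \<open>A \<inter> B\<close> crosses \<open>A\<close> and \<open>B\<close>; a pair that crosses one of
  \<open>A \<union> B\<close>, \<open>A \<inter> B\<close> crosses one of \<open>A\<close>, \<open>B\<close>.
\<close>

lemma emeasure_crossing_submodular:
  assumes "\<And>E. E \<in> \<A> \<Longrightarrow> crossing \<Omega> E \<in> sets \<nu>"
    and "A \<in> \<A>" "B \<in> \<A>" "A \<union> B \<in> \<A>" "A \<inter> B \<in> \<A>"
  shows "emeasure \<nu> (crossing \<Omega> (A \<union> B)) + emeasure \<nu> (crossing \<Omega> (A \<inter> B))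
    \<le> emeasure \<nu> (crossing \<Omega> A) + emeasure \<nu> (crossing \<Omega> B)"
proof -
  let ?C = "crossing \<Omega>"
  have "emeasure \<nu> (?C (A \<union> B)) + emeasure \<nu> (?C (A \<inter> B)) =
      emeasure \<nu> (?C (A \<union> B) \<union> ?C (A \<inter> B)) + emeasure \<nu> (?C (A \<union> B) \<inter> ?C (A \<inter> B))"
    by (intro emeasure_Un_Int assms)
  also have "\<dots> \<le> emeasure \<nu> (?C A \<union> ?C B) + emeasure \<nu> (?C A \<inter> ?C B)"
    using assms by (intro add_mono emeasure_mono) (auto simp: crossing_def)
  also have "\<dots> = emeasure \<nu> (?C A) + emeasure \<nu> (?C B)"
    by (intro emeasure_Un_Int[symmetric] assms)
  finally show ?thesis .
qed

text \<open>
  Fatou's lemma for sets: a pair that crosses the pointwise limit crosses all but finitely many of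
  the sets \<open>X n\<close>.
\<close>

lemma emeasure_crossing_lsc:
  fixes X :: "nat \<Rightarrow> 'a set"
  assumes C: "\<And>n. crossing \<Omega> (X n) \<in> sets \<nu>"
    and lim: "\<And>x. \<forall>\<^sub>F n in sequentially. x \<in> X n \<longleftrightarrow> x \<in> E"
    and le: "\<And>n. emeasure \<nu> (crossing \<Omega> (X n)) \<le> c"
  shows "emeasure \<nu> (crossing \<Omega> E) \<le> c"
proof -
  define T where "T N = (\<Inter>n\<in>{N..}. crossing \<Omega> (X n))" for N
  have T: "T N \<in> sets \<nu>" for N
    unfolding T_def using C by (intro sets.countable_INT) auto
  have "crossing \<Omega> E \<subseteq> (\<Union>N. T N)"
  proof safe
    fix x y
    assume xy: "(x, y) \<in> crossing \<Omega> E"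
    have "\<forall>\<^sub>F n in sequentially. (x, y) \<in> crossing \<Omega> (X n)"
      using lim[of x] lim[of y] by eventually_elim (use xy in \<open>auto simp: crossing_def\<close>)
    then show "(x, y) \<in> (\<Union>N. T N)"
      by (auto simp: eventually_sequentially T_def)
  qed
  then have "emeasure \<nu> (crossing \<Omega> E) \<le> emeasure \<nu> (\<Union>N. T N)"
    using T by (intro emeasure_mono) auto
  also have "\<dots> = (SUP N. emeasure \<nu> (T N))"
    using T by (intro SUP_emeasure_incseq[symmetric]) (force simp: T_def incseq_def)+
  also have "\<dots> \<le> c"
  proof (rule SUP_least)
    fix N
    have "emeasure \<nu> (T N) \<le> emeasure \<nu> (crossing \<Omega> (X N))"
      by (intro emeasure_mono C) (auto simp: T_def)
    then show "emeasure \<nu> (T N) \<le> c"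
      using le order_trans by blast
  qed
  finally show ?thesis .
qed

lemma emeasure_crossing_attains_min:
  assumes \<nu>: "sets \<nu> = sets (M \<Otimes>\<^sub>M M)" and M: "space M = UNIV" and \<Omega>: "\<Omega> \<in> sets M"
    and E0: "E\<^sub>0 \<in> sets M"
  defines "\<A> \<equiv> {F \<in> sets M. F \<inter> - \<Omega> = E\<^sub>0 \<inter> - \<Omega>}"
  shows "\<exists>E\<in>\<A>. \<forall>F\<in>\<A>. emeasure \<nu> (crossing \<Omega> E) \<le> emeasure \<nu> (crossing \<Omega> F)"
proof -
  have C: "crossing \<Omega> A \<in> sets \<nu>" if "A \<in> \<A>" for A
    using that sets_crossing[OF M _ \<Omega>] by (auto simp: \<A>_def \<nu>)
  show ?thesis
  proof (rule submodular_attains_min)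
    show "\<A> \<noteq> {}"
      using E0 by (auto simp: \<A>_def)
    show UN: "(\<Union>n::nat. X n) \<in> \<A>" if "range X \<subseteq> \<A>" for X
    proof -
      have "(\<Union>n. X n) \<inter> - \<Omega> = (\<Union>n. X n \<inter> - \<Omega>)"
        by auto
      also have "\<dots> = E\<^sub>0 \<inter> - \<Omega>"
        using that by (auto simp: \<A>_def)
      finally have "(\<Union>n. X n) \<inter> - \<Omega> = E\<^sub>0 \<inter> - \<Omega>" .
      moreover have "range X \<subseteq> sets M"
        using that by (auto simp: \<A>_def)
      ultimately show ?thesis
        by (simp add: \<A>_def sets.countable_UN)
    qed
    show INT: "(\<Inter>n::nat. X n) \<in> \<A>" if "range X \<subseteq> \<A>" for X
    proof -
      have "(\<Inter>n. X n) \<inter> - \<Omega> = (\<Inter>n. X n \<inter> - \<Omega>)"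
        by auto
      also have "\<dots> = E\<^sub>0 \<inter> - \<Omega>"
        using that by (auto simp: \<A>_def)
      finally have "(\<Inter>n. X n) \<inter> - \<Omega> = E\<^sub>0 \<inter> - \<Omega>" .
      moreover have "range X \<subseteq> sets M"
        using that by (auto simp: \<A>_def)
      ultimately show ?thesis
        by (simp add: \<A>_def sets.countable_INT)
    qed
    show "emeasure \<nu> (crossing \<Omega> (A \<union> B)) + emeasure \<nu> (crossing \<Omega> (A \<inter> B))
        \<le> emeasure \<nu> (crossing \<Omega> A) + emeasure \<nu> (crossing \<Omega> B)" if "A \<in> \<A>" "B \<in> \<A>" for A B
      using that by (intro emeasure_crossing_submodular[where \<A> = \<A>] C) (auto simp: \<A>_def)
    show "emeasure \<nu> (crossing \<Omega> (\<Union>n. X n)) \<le> c"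
      if X: "range X \<subseteq> \<A>" "incseq X" and le: "\<And>n::nat. emeasure \<nu> (crossing \<Omega> (X n)) \<le> c" for X c
    proof (rule emeasure_crossing_lsc[OF C _ le])
      show "X n \<in> \<A>" for n
        using X by auto
      show "\<forall>\<^sub>F n in sequentially. x \<in> X n \<longleftrightarrow> x \<in> (\<Union>n. X n)" for x
      proof (cases "x \<in> (\<Union>n. X n)")
        case True
        then obtain N where "x \<in> X N"
          by auto
        then show ?thesis
          using incseqD[OF X(2)] by (auto simp: eventually_sequentially)
      qed auto
    qed
    show "emeasure \<nu> (crossing \<Omega> (\<Inter>n. X n)) \<le> c"
      if X: "range X \<subseteq> \<A>" "decseq X" and le: "\<And>n::nat. emeasure \<nu> (crossing \<Omega> (X n)) \<le> c" for X c
    proof (rule emeasure_crossing_lsc[OF C _ le])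
      show "X n \<in> \<A>" for n
        using X by auto
      show "\<forall>\<^sub>F n in sequentially. x \<in> X n \<longleftrightarrow> x \<in> (\<Inter>n. X n)" for x
      proof (cases "x \<in> (\<Inter>n. X n)")
        case False
        then obtain N where "x \<notin> X N"
          by auto
        then show ?thesis
          using decseqD[OF X(2)] False by (auto simp: eventually_sequentially)
      qed auto
    qed
  qed
qed


section \<open>The interaction as a measure of rectangles\<close>

lemma sigma_finite_lebesgue: "sigma_finite_measure (lebesgue :: 'a::euclidean_space measure)"
proof
  obtain S :: "'a set set" where S: "countable S" "S \<subseteq> sets lborel" "\<Union>S = space lborel"
      "\<forall>a\<in>S. emeasure lborel a \<noteq> \<infinity>"
    using lborel.sigma_finite_countable by blast
  then have "S \<subseteq> sets lebesgue" "\<Union>S = space lebesgue" "\<forall>a\<in>S. emeasure lebesgue a \<noteq> \<infinity>"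
    by auto
  with S(1) show "\<exists>A::'a set set. countable A \<and> A \<subseteq> sets lebesgue \<and> \<Union> A = space lebesgue \<and>
      (\<forall>a\<in>A. emeasure lebesgue a \<noteq> \<infinity>)"
    by blast
qed

lemma AE_lebesgue_reflect:
  fixes P :: "'a::euclidean_space \<Rightarrow> bool"
  assumes "AE z in lebesgue. P z"
  shows "AE z in lebesgue. P (c - z)"
proof -
  obtain N where N: "negligible N" "{z. \<not> P z} \<subseteq> N"
    using assms by (auto simp: eventually_ae_filter_negligible)
  have "negligible ((\<lambda>z. c - z) ` N)"
    by (rule negligible_differentiable_image_negligible[OF _ N(1)]) (auto intro!: derivative_intros)
  moreover have "{z. \<not> P (c - z)} \<subseteq> (\<lambda>z. c - z) ` N"
    using N(2) by (auto intro!: image_eqI[of _ _ "c - _"])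
  ultimately show ?thesis
    unfolding eventually_ae_filter_negligible by blast
qed

lemma AE_lebesgue_translate:
  fixes P :: "'a::euclidean_space \<Rightarrow> bool"
  assumes "AE z in lebesgue. P z"
  shows "AE z in lebesgue. P (z - c)"
  using AE_lebesgue_reflect[OF AE_lebesgue_reflect[OF assms, of 0], of c] by simp

text \<open>
  If \<open>K\<close> is only Lebesgue measurable, \<open>K (y - x)\<close> need not be measurable for the product
  \<open>\<sigma>\<close>-algebra, so Fubini's theorem does not apply to it. A Borel version of \<open>K\<close> gives the same
  integrals; taking the maximum with its reflection keeps it even.
\<close>

lemma even_Borel_version:
  fixes K :: "'a::euclidean_space \<Rightarrow> real"
  assumes "K \<in> borel_measurable lebesgue" and even: "\<And>h. K h = K (- h)"
  obtains g where "g \<in> borel_measurable borel" "\<And>h. g h = g (- h)" "AE z in lebesgue. K z = g z"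
proof -
  obtain g where g: "g \<in> borel_measurable lborel" "AE z in lborel. K z = g z"
    using completion_ex_borel_measurable_real[OF assms(1)] by blast
  have [measurable]: "g \<in> borel_measurable borel"
    using g(1) by simp
  have ae: "AE z in lebesgue. K z = g z"
    using g(2) by (rule AE_completion)
  show ?thesis
  proof (rule that[of "\<lambda>z. max (g z) (g (- z))"])
    show "AE z in lebesgue. K z = max (g z) (g (- z))"
      using ae AE_lebesgue_reflect[OF ae, of 0]
    proof eventually_elim
      case (elim z)
      then show ?case
        using even[of z] by simp
    qed
  qed (auto simp: max.commute)
qed

text \<open>
  The symmetry of the interaction is needed because the rectangles destroyed and created by a
  competitor have the varied set \<open>F\<close> on opposite sides.
\<close>

lemma interaction_measure:
  fixes K :: "'a::euclidean_space \<Rightarrow> real"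
  assumes K: "K \<in> borel_measurable lebesgue" and even: "\<And>h. K h = K (- h)"
  obtains \<nu> :: "('a \<times> 'a) measure" where "sets \<nu> = sets (lebesgue \<Otimes>\<^sub>M lebesgue)"
    and "\<And>A B. A \<in> sets lebesgue \<Longrightarrow> B \<in> sets lebesgue \<Longrightarrow> L_K K A B = emeasure \<nu> (B \<times> A)"
    and "\<And>A B. A \<in> sets lebesgue \<Longrightarrow> B \<in> sets lebesgue \<Longrightarrow> L_K K A B = L_K K B A"
proof -
  interpret L: sigma_finite_measure "lebesgue :: 'a measure"
    by (rule sigma_finite_lebesgue)
  interpret pair_sigma_finite "lebesgue :: 'a measure" "lebesgue :: 'a measure" ..
  obtain g where g [measurable]: "g \<in> borel_measurable borel" and g_even: "\<And>h. g h = g (- h)"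
    and ae: "AE z in lebesgue. K z = g z"
    using even_Borel_version[OF K even] by blast
  define k where "k = (\<lambda>(x, y). ennreal (g (y - x)))"
  have id [measurable]: "(\<lambda>x::'a. x) \<in> lebesgue \<rightarrow>\<^sub>M borel"
    by (rule measurable_completion) simp
  have diff [measurable]: "(\<lambda>p::'a \<times> 'a. snd p - fst p) \<in> lebesgue \<Otimes>\<^sub>M lebesgue \<rightarrow>\<^sub>M borel"
    by (intro borel_measurable_diff measurable_compose[OF measurable_snd id]
        measurable_compose[OF measurable_fst id])
  have k [measurable]: "k \<in> borel_measurable (lebesgue \<Otimes>\<^sub>M lebesgue)"
    unfolding k_def split_beta by measurable
  define \<nu> where "\<nu> = density (lebesgue \<Otimes>\<^sub>M lebesgue) k"
  have \<nu>: "emeasure \<nu> (B \<times> A) = (\<integral>\<^sup>+x\<in>B. (\<integral>\<^sup>+y\<in>A. k (x, y) \<partial>lebesgue) \<partial>lebesgue)"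
    if [measurable]: "A \<in> sets lebesgue" "B \<in> sets lebesgue" for A B
  proof -
    have "emeasure \<nu> (B \<times> A) = (\<integral>\<^sup>+p. k p * indicator (B \<times> A) p \<partial>(lebesgue \<Otimes>\<^sub>M lebesgue))"
      unfolding \<nu>_def by (rule emeasure_density) auto
    also have "\<dots> = (\<integral>\<^sup>+x. \<integral>\<^sup>+y. k (x, y) * indicator (B \<times> A) (x, y) \<partial>lebesgue \<partial>lebesgue)"
      by (rule L.nn_integral_fst[symmetric]) measurable
    also have "\<dots> = (\<integral>\<^sup>+x\<in>B. (\<integral>\<^sup>+y\<in>A. k (x, y) \<partial>lebesgue) \<partial>lebesgue)"
      by (intro nn_integral_cong) (auto simp: indicator_def)
    finally show ?thesis .
  qed
  have L: "L_K K A B = emeasure \<nu> (B \<times> A)" if "A \<in> sets lebesgue" "B \<in> sets lebesgue" for A B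
  proof -
    have "(\<integral>\<^sup>+y\<in>A. ennreal (K (y - x)) \<partial>lebesgue) = (\<integral>\<^sup>+y\<in>A. k (x, y) \<partial>lebesgue)" for x
      using AE_lebesgue_translate[OF ae, of x] by (intro nn_integral_cong_AE) (auto simp: k_def)
    then show ?thesis
      using \<nu>[OF that] by (simp add: L_K_def)
  qed
  have "emeasure \<nu> (B \<times> A) = emeasure \<nu> (A \<times> B)"
    if [measurable]: "A \<in> sets lebesgue" "B \<in> sets lebesgue" for A B
  proof -
    have k_sym: "k (x, y) = k (y, x)" for x y
      using g_even[of "y - x"] by (simp add: k_def)
    have "emeasure \<nu> (B \<times> A) =
        (\<integral>\<^sup>+x. \<integral>\<^sup>+y. k (x, y) * indicator (B \<times> A) (x, y) \<partial>lebesgue \<partial>lebesgue)"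
      unfolding \<nu>[OF that] by (intro nn_integral_cong) (auto simp: indicator_def)
    also have "\<dots> = (\<integral>\<^sup>+y. \<integral>\<^sup>+x. k (x, y) * indicator (B \<times> A) (x, y) \<partial>lebesgue \<partial>lebesgue)"
      by (rule Fubini[symmetric]) measurable
    also have "\<dots> = emeasure \<nu> (A \<times> B)"
      unfolding \<nu>[OF that(2,1)]
      by (intro nn_integral_cong) (auto simp: indicator_def k_sym intro!: nn_integral_cong)
    finally show ?thesis .
  qed
  with L show ?thesis
    by (intro that[of \<nu>]) (auto simp: \<nu>_def)
qed


section \<open>Existence and Euler--Lagrange inequalities\<close>

text \<open>
  Used with \<open>R\<close> the crossing pairs that a minimiser shares with its competitor, \<open>P\<close> the pairs that
  the competitor destroys and \<open>Q\<close> those that it creates. The finite mass of \<open>R\<close> cancels.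
\<close>

lemma emeasure_exchange_le:
  assumes "P \<in> sets \<nu>" "Q \<in> sets \<nu>" "R \<in> sets \<nu>" "R \<inter> P = {}" "R \<inter> Q = {}"
    and "emeasure \<nu> (R \<union> P) < \<infinity>" and "emeasure \<nu> (R \<union> P) \<le> emeasure \<nu> (R \<union> Q)"
  shows "emeasure \<nu> P \<le> emeasure \<nu> Q"
proof -
  have "emeasure \<nu> R + emeasure \<nu> P \<le> emeasure \<nu> R + emeasure \<nu> Q"
    using assms by (simp add: plus_emeasure)
  moreover have "emeasure \<nu> R \<le> emeasure \<nu> (R \<union> P)"
    using assms by (intro emeasure_mono) auto
  ultimately show ?thesis
    using assms(6) by (auto simp: ennreal_add_left_cancel_le)
qed

theorem theorem2p10:
  fixes K :: "real ^ 'd \<Rightarrow> real" and \<Omega> E\<^sub>0 :: "(real ^ 'd) set"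
  assumes "K \<in> borel_measurable lebesgue"
    and "\<And>h. K h \<ge> 0"
    and "\<And>h. K h = K (- h)"
    and "open \<Omega>" and "bounded \<Omega>" and "\<Omega> \<noteq> {}"
    and "E\<^sub>0 \<in> sets lebesgue"
    and "Per_K K E\<^sub>0 \<Omega> < \<infinity>"
  shows "(\<exists>E \<in> admissible_sets K \<Omega> E\<^sub>0. \<forall>F \<in> admissible_sets K \<Omega> E\<^sub>0. Per_K K E \<Omega> \<le> Per_K K F \<Omega>) \<and>
    (\<forall>E. is_minimiser K \<Omega> E\<^sub>0 E \<longrightarrow>
      (\<forall>F \<in> sets lebesgue. F \<subseteq> - E \<inter> \<Omega> \<longrightarrow> L_K K E F \<le> L_K K (- E \<inter> - F) F) \<and>
      (\<forall>F \<in> sets lebesgue. F \<subseteq> E \<inter> \<Omega> \<longrightarrow> L_K K (- E) F \<le> L_K K (E \<inter> - F) F))"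
proof -
  obtain \<nu> where \<nu>: "sets \<nu> = sets (lebesgue \<Otimes>\<^sub>M (lebesgue :: (real ^ 'd) measure))"
    and L: "\<And>A B. A \<in> sets lebesgue \<Longrightarrow> B \<in> sets lebesgue \<Longrightarrow> L_K K A B = emeasure \<nu> (B \<times> A)"
    and sym: "\<And>A B. A \<in> sets lebesgue \<Longrightarrow> B \<in> sets lebesgue \<Longrightarrow> L_K K A B = L_K K B A"
    using interaction_measure[OF assms(1,3)] by blast
  have \<Omega>: "\<Omega> \<in> sets lebesgue"
    using assms(4) by (simp add: borel_open sets_completionI_sets)
  have compl: "- A \<in> sets lebesgue" if "A \<in> sets lebesgue" for A :: "(real ^ 'd) set"
    using sets.compl_sets[OF that] by (simp add: Compl_eq_Diff_UNIV)
  have C: "crossing \<Omega> E \<in> sets \<nu>" if "E \<in> sets lebesgue" for E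
    unfolding \<nu> by (intro sets_crossing that \<Omega>) simp
  have rect: "A \<times> B \<in> sets \<nu>" if "A \<in> sets lebesgue" "B \<in> sets lebesgue" for A B
    unfolding \<nu> using that by auto
  have Per: "Per_K K E \<Omega> = emeasure \<nu> (crossing \<Omega> E)" if E: "E \<in> sets lebesgue" for E
  proof -
    let ?R1 = "(- E \<inter> \<Omega>) \<times> (E \<inter> \<Omega>)" and ?R2 = "(- E \<inter> - \<Omega>) \<times> (E \<inter> \<Omega>)"
      and ?R3 = "(- E \<inter> \<Omega>) \<times> (E \<inter> - \<Omega>)"
    have R: "?R1 \<in> sets \<nu>" "?R2 \<in> sets \<nu>" "?R3 \<in> sets \<nu>"
      using E \<Omega> compl by (auto intro!: rect)
    have "Per_K K E \<Omega> = emeasure \<nu> ?R1 + emeasure \<nu> ?R2 + emeasure \<nu> ?R3"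
      unfolding Per_K_def using E \<Omega> compl by (simp add: L sets.Int)
    also have "emeasure \<nu> ?R1 + emeasure \<nu> ?R2 = emeasure \<nu> (?R1 \<union> ?R2)"
      using R by (intro plus_emeasure) auto
    also have "\<dots> + emeasure \<nu> ?R3 = emeasure \<nu> (?R1 \<union> ?R2 \<union> ?R3)"
      using R by (intro plus_emeasure) auto
    finally show ?thesis
      by (simp add: crossing_eq_rectangles)
  qed
  have "\<exists>E \<in> admissible_sets K \<Omega> E\<^sub>0. \<forall>F \<in> admissible_sets K \<Omega> E\<^sub>0. Per_K K E \<Omega> \<le> Per_K K F \<Omega>"
  proof -
    obtain E where E: "E \<in> sets lebesgue" "E \<inter> - \<Omega> = E\<^sub>0 \<inter> - \<Omega>"
      and min: "\<And>F. F \<in> sets lebesgue \<Longrightarrow> F \<inter> - \<Omega> = E\<^sub>0 \<inter> - \<Omega> \<Longrightarrow>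
        emeasure \<nu> (crossing \<Omega> E) \<le> emeasure \<nu> (crossing \<Omega> F)"
      using emeasure_crossing_attains_min[OF \<nu> _ \<Omega> assms(7)] by auto
    have "Per_K K E \<Omega> < \<infinity>"
      using min[OF assms(7) refl] assms(7,8) E by (simp add: Per order_le_less_trans)
    with E min show ?thesis
      by (intro bexI[of _ E]) (auto simp: admissible_sets_def Per)
  qed
  moreover
  {
    fix E
    assume min: "is_minimiser K \<Omega> E\<^sub>0 E"
    then have E: "E \<in> sets lebesgue" "E \<inter> - \<Omega> = E\<^sub>0 \<inter> - \<Omega>" and "Per_K K E \<Omega> < \<infinity>"
      by (auto simp: is_minimiser_def admissible_sets_def)
    then have fin: "emeasure \<nu> (crossing \<Omega> E) < \<infinity>"
      by (simp add: Per)
    \<comment> \<open>A competitor of infinite perimeter is not admissible, but the comparison is then trivial.\<close>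
    have le: "emeasure \<nu> (crossing \<Omega> E) \<le> emeasure \<nu> (crossing \<Omega> G)"
      if G: "G \<in> sets lebesgue" "G \<inter> - \<Omega> = E \<inter> - \<Omega>" for G
    proof (cases "Per_K K G \<Omega> < \<infinity>")
      case True
      then have "Per_K K E \<Omega> \<le> Per_K K G \<Omega>"
        using min G E by (auto simp: is_minimiser_def admissible_sets_def)
      then show ?thesis
        using E G by (simp add: Per)
    next
      case False
      then show ?thesis
        using G by (simp add: Per top.not_eq_extremum[symmetric])
    qed
    have "L_K K E F \<le> L_K K (- E \<inter> - F) F" if F: "F \<in> sets lebesgue" "F \<subseteq> - E \<inter> \<Omega>" for F
    proof -
      let ?P = "F \<times> E" and ?Q = "(- E \<inter> - F) \<times> F"
      let ?R = "crossing \<Omega> E - ?P"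
      have split: "crossing \<Omega> E = ?R \<union> ?P" "crossing \<Omega> (E \<union> F) = ?R \<union> ?Q"
        using F(2) by (auto simp: crossing_def)
      have "emeasure \<nu> ?P \<le> emeasure \<nu> ?Q"
      proof (rule emeasure_exchange_le[where R = ?R])
        show "?P \<in> sets \<nu>" "?Q \<in> sets \<nu>" "?R \<in> sets \<nu>"
          using E(1) F(1) compl C by (auto intro!: rect)
        show "?R \<inter> ?P = {}" "?R \<inter> ?Q = {}"
          using F(2) by (auto simp: crossing_def)
        show "emeasure \<nu> (?R \<union> ?P) < \<infinity>"
          using fin split(1) by simp
        show "emeasure \<nu> (?R \<union> ?P) \<le> emeasure \<nu> (?R \<union> ?Q)"
          using le[of "E \<union> F"] E(1) F split by auto
      qed
      moreover have meas: "- E \<inter> - F \<in> sets lebesgue"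
        using E(1) F(1) compl by (intro sets.Int)
      ultimately show ?thesis
        using L[OF E(1) F(1)] L[OF F(1) meas] sym[OF F(1) meas] by simp
    qed
    moreover have "L_K K (- E) F \<le> L_K K (E \<inter> - F) F" if F: "F \<in> sets lebesgue" "F \<subseteq> E \<inter> \<Omega>" for F
    proof -
      let ?P = "(- E) \<times> F" and ?Q = "F \<times> (E \<inter> - F)"
      let ?R = "crossing \<Omega> E - ?P"
      have split: "crossing \<Omega> E = ?R \<union> ?P" "crossing \<Omega> (E - F) = ?R \<union> ?Q"
        using F(2) by (auto simp: crossing_def)
      have "emeasure \<nu> ?P \<le> emeasure \<nu> ?Q"
      proof (rule emeasure_exchange_le[where R = ?R])
        show "?P \<in> sets \<nu>" "?Q \<in> sets \<nu>" "?R \<in> sets \<nu>"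
          using E(1) F(1) compl C by (auto intro!: rect)
        show "?R \<inter> ?P = {}" "?R \<inter> ?Q = {}"
          using F(2) by (auto simp: crossing_def)
        show "emeasure \<nu> (?R \<union> ?P) < \<infinity>"
          using fin split(1) by simp
        show "emeasure \<nu> (?R \<union> ?P) \<le> emeasure \<nu> (?R \<union> ?Q)"
          using le[of "E - F"] E(1) F split by auto
      qed
      moreover have meas: "E \<inter> - F \<in> sets lebesgue"
        using E(1) F(1) compl by (intro sets.Int)
      ultimately show ?thesis
        using L[OF F(1) compl[OF E(1)]] L[OF meas F(1)] sym[OF F(1) compl[OF E(1)]] by simp
    qed
    ultimately have "(\<forall>F \<in> sets lebesgue. F \<subseteq> - E \<inter> \<Omega> \<longrightarrow> L_K K E F \<le> L_K K (- E \<inter> - F) F) \<and>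
        (\<forall>F \<in> sets lebesgue. F \<subseteq> E \<inter> \<Omega> \<longrightarrow> L_K K (- E) F \<le> L_K K (E \<inter> - F) F)"
      by blast
  }
  ultimately show ?thesis
    by blast
qed

end
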